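(* Let $(\mathcal X,\mathcal X^\Omega)$ be a quasi-universal space. Then there is the equality of quasi-universal spaces (underlying sets and admissible random variables) $$\mathsf S(\mathcal X,\mathcal X^\Omega)=\mathsf P(\mathcal X,\mathcal X^\Omega)=\mathsf R(\mathcal X,\mathcal X^\Omega)=\mathsf K(\mathcal X,\mathcal X^\Omega).$$ If, furthermore, $\nu=U[0,1]$ is the uniform distribution on $\Omega\cong[0,1]$, then $$\mathsf P(\mathcal X,\mathcal X^\Omega)=\{X_*\nu\mid X\in\mathcal X^\Omega\},\qquad \mathsf P(\mathcal X,\mathcal X^\Omega)^\Omega=\{X_*\phi_*\nu\mid X\in\mathcal X^\Omega,\ \phi\in(\Omega^\Omega)^\Omega\},$$ where $X_*\phi_*\nu$ denotes the map $\omega\mapsto X_*(\phi(\omega)_*\nu)$. In particular, the map $$\mathcal X^\Omega\to\mathsf P(\mathcal X,\mathcal X^\Omega),\qquad X\mapsto X_*\nu,$$ is a well-defined (surjective) quotient map of quasi-universal spaces.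
   Context: Fix the sample space: $\Omega=[0,1]^{\mathbb N}$, $\mathcal B_\Omega$ the $\sigma$-algebra of all universally measurable subsets of $\Omega$, $\Omega^\Omega$ the set of all measurable maps $(\Omega,\mathcal B_\Omega)\to(\Omega,\mathcal B_\Omega)$, $\mathsf G(\Omega)$ the set of all probability measures on $(\Omega,\mathcal B_\Omega)$. "$\Omega\cong[0,1]$" means a fixed Borel isomorphism between $[0,1]^{\mathbb N}$ and $[0,1]$ along which the uniform distribution of $[0,1]$ (extended to universally measurable sets) is transported to $\Omega$. A quasi-universal space is a pair $(\mathcal X,\mathcal X^\Omega)$ of a set and a set $\mathcal X^\Omega$ of maps $\Omega\to\mathcal X$ (admissible random variables) containing all constants and closed under $X\mapsto X\circ\Phi$, $\Phi\in\Omega^\Omega$; $g:\mathcal X\to\mathcal Y$ is quasi-measurable if $g\circ\mathcal X^\Omega\subseteq\mathcal Y^\Omega$; products carry componentwise structure. $\mathcal X^\Omega$ is itself a quasi-universal space whose admissible random variables $(\mathcal X^\Omega)^\Omega$ are the maps $X:\Omega\to\mathcal X^\Omega$ with $(\omega,\omega')\mapsto X(\omega)(\omega')$ quasi-measurable $\Omega\times\Omega\to\mathcal X$; likewise $(\Omega^\Omega)^\Omega$. The induced $\sigma$-algebra is $\mathcal B_{\mathcal X}=\{A\subseteq\mathcal X\mid X^{-1}(A)\in\mathcal B_\Omega\ \forall X\in\mathcal X^\Omega\}$. A quotient map is a surjective quasi-measurable map $f:\mathcal X\to\mathcal Y$ with $\mathcal Y^\Omega=f\circ\mathcal X^\Omega$.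 $\mathsf Q(\Omega)$ is the quasi-universal space of those $\mu\in\mathsf G(\Omega)$ for which $\omega\mapsto\mu(D_\omega)$ is $\mathcal B_\Omega$-measurable for every $D\in\mathcal B_{\Omega\times\Omega}$, with $D_\omega=\{\omega'\mid(\omega,\omega')\in D\}$; its admissible random variables $\mathsf Q(\Omega)^\Omega$ are the maps $\kappa:\Omega\to\mathsf Q(\Omega)$ such that $\omega\mapsto\kappa(\Phi(\omega))(D_\omega)$ is $\mathcal B_\Omega$-measurable for all $\Phi\in\Omega^\Omega$, $D\in\mathcal B_{\Omega\times\Omega}$. Four quasi-universal spaces of push-forward measures on $\mathcal B_{\mathcal X}$. Underlying sets: $\mathsf K(\mathcal X)=\mathsf R(\mathcal X)=\{X_*\mu\mid X\in\mathcal X^\Omega,\mu\in\mathsf Q(\Omega)\}$ and $\mathsf P(\mathcal X)=\mathsf S(\mathcal X)=\{X_*P\mid X\in\mathcal X^\Omega,P\in\mathsf G(\Omega)\}$. Admissible random variables: - $\mathsf K(\mathcal X)^\Omega$: all $\omega\mapsto X(\omega)_*\kappa(\omega)$ with $X\in(\mathcal X^\Omega)^\Omega$, $\kappa\in\mathsf Q(\Omega)^\Omega$; - $\mathsf R(\mathcal X)^\Omega$: all $\omega\mapsto X_*\kappa(\omega)$ with $X\in\mathcal X^\Omega$, $\kappa\in\mathsf Q(\Omega)^\Omega$; - $\mathsf P(\mathcal X)^\Omega$: all $\omega\mapsto X(\omega)_*P$ with $X\in(\mathcal X^\Omega)^\Omega$, $P\in\mathsf G(\Omega)$; - $\mathsf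 S(\mathcal X)^\Omega$: all $\omega\mapsto X_*\phi(\omega)_*P$ with $X\in\mathcal X^\Omega$, $\phi\in(\Omega^\Omega)^\Omega$, $P\in\mathsf G(\Omega)$. *)

theory Defs
  imports "HOL-Probability.Probability"
begin

typedef unit_interval = "{0..1::real}"
  by auto

instantiation unit_interval :: metric_space
begin

definition dist_unit_interval :: "unit_interval \<Rightarrow> unit_interval \<Rightarrow> real" where
  "dist_unit_interval x y = dist (Rep_unit_interval x) (Rep_unit_interval y)"

definition uniformity_unit_interval :: "(unit_interval \<times> unit_interval) filter" where
  "uniformity_unit_interval = (INF e\<in>{0 <..}. principal {(x, y). dist x y < e})"

definition open_unit_interval :: "unit_interval set \<Rightarrow> bool" where
  "open_unit_interval U = (\<forall>x\<in>U. \<forall>\<^sub>F (x', y) in uniformity. x' = x \<longrightarrow> y \<in> U)"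

instance
proof
  fix x y z :: unit_interval
  show "dist x y = 0 \<longleftrightarrow> x = y"
    by (simp add: dist_unit_interval_def Rep_unit_interval_inject)
  show "dist x y \<le> dist x z + dist y z"
    unfolding dist_unit_interval_def by (rule dist_triangle2)
qed (simp_all only: uniformity_unit_interval_def open_unit_interval_def)

end

text \<open>The function type carries the product topology, so \<open>borel :: omega measure\<close> is the Borel
  \<open>\<sigma>\<close>-algebra of the Hilbert cube \<open>[0,1]\<^sup>\<nat>\<close>.\<close>

type_synonym omega = "nat \<Rightarrow> unit_interval"

text \<open>The collections passed to \<open>sigma\<close> in \<open>universal\<close> and \<open>induced\<close> below are already
  \<open>\<sigma>\<close>-algebras (\<open>sets_universal\<close>, \<open>sets_induced\<close>); \<open>sigma\<close> only packages them as measurable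
  spaces.\<close>

definition universally_measurable_sets :: "'a measure \<Rightarrow> 'a set set" where
  "universally_measurable_sets M =
     {A. A \<subseteq> space M \<and> (\<forall>\<mu>\<in>space (prob_algebra M). A \<in> sets (completion \<mu>))}"

definition universal :: "'a measure \<Rightarrow> 'a measure" where
  "universal M = sigma (space M) (universally_measurable_sets M)"

abbreviation B_Omega :: "omega measure" where
  "B_Omega \<equiv> universal borel"

lemma space_universal [simp]: "space (universal M) = space M"
  unfolding universal_def universally_measurable_sets_def by (rule space_measure_of) auto

lemma sets_universal: "sets (universal M) = universally_measurable_sets M"
proof -
  have sp: "space (completion \<mu>) = space M" if "\<mu> \<in> space (prob_algebra M)" for \<mu>
    using that by (auto simp: space_prob_algebra dest: sets_eq_imp_space_eq)
  have "sigma_algebra (space M) (universally_measurable_sets M)"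
    unfolding sigma_algebra_iff2
  proof (intro conjI allI impI ballI)
    fix A assume "A \<in> universally_measurable_sets M"
    then show "space M - A \<in> universally_measurable_sets M"
      unfolding universally_measurable_sets_def
      by clarsimp (metis sp sets.compl_sets)
  qed (auto simp: universally_measurable_sets_def intro!: sets.countable_UN)
  then show ?thesis
    unfolding universal_def by (rule sigma_algebra.sets_measure_of_eq)
qed

abbreviation G_Omega :: "omega measure set" where
  "G_Omega \<equiv> space (prob_algebra B_Omega)"

datatype 'a qspace = QSpace (points: "'a set") (adm: "(omega \<Rightarrow> 'a) set")

definition Omega :: "omega qspace" where
  "Omega = QSpace UNIV (B_Omega \<rightarrow>\<^sub>M B_Omega)"

definition quasi_universal :: "'a qspace \<Rightarrow> bool" where
  "quasi_universal X \<longleftrightarrow>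
     (\<forall>Y\<in>adm X. range Y \<subseteq> points X) \<and>
     (\<forall>x\<in>points X. (\<lambda>_. x) \<in> adm X) \<and>
     (\<forall>Y\<in>adm X. \<forall>\<Phi>\<in>adm Omega. Y \<circ> \<Phi> \<in> adm X)"

definition quasi_measurable :: "'a qspace \<Rightarrow> 'b qspace \<Rightarrow> ('a \<Rightarrow> 'b) \<Rightarrow> bool" where
  "quasi_measurable X Y g \<longleftrightarrow> g ` points X \<subseteq> points Y \<and> (\<forall>Z\<in>adm X. g \<circ> Z \<in> adm Y)"

definition quasi_quotient_map :: "'a qspace \<Rightarrow> 'b qspace \<Rightarrow> ('a \<Rightarrow> 'b) \<Rightarrow> bool" where
  "quasi_quotient_map X Y f \<longleftrightarrow>
     quasi_universal X \<and> quasi_universal Y \<and> quasi_measurable X Y f \<and>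
     f ` points X = points Y \<and> adm Y = (\<lambda>Z. f \<circ> Z) ` adm X"

definition prod_qspace :: "'a qspace \<Rightarrow> 'b qspace \<Rightarrow> ('a \<times> 'b) qspace" where
  "prod_qspace X Y =
     QSpace (points X \<times> points Y) {\<lambda>\<omega>. (U \<omega>, V \<omega>) | U V. U \<in> adm X \<and> V \<in> adm Y}"

definition rv_qspace :: "'a qspace \<Rightarrow> (omega \<Rightarrow> 'a) qspace" where
  "rv_qspace X =
     QSpace (adm X)
       {Z. range Z \<subseteq> adm X \<and> quasi_measurable (prod_qspace Omega Omega) X (\<lambda>(\<omega>, \<omega>'). Z \<omega> \<omega>')}"

definition induced_sets :: "'a qspace \<Rightarrow> 'a set set" where
  "induced_sets X = {A. A \<subseteq> points X \<and> (\<forall>Y\<in>adm X. Y -` A \<in> sets B_Omega)}"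

definition induced :: "'a qspace \<Rightarrow> 'a measure" where
  "induced X = sigma (points X) (induced_sets X)"

lemma space_induced [simp]: "space (induced X) = points X"
  unfolding induced_def induced_sets_def by (rule space_measure_of) auto

lemma sets_induced:
  assumes "quasi_universal X"
  shows "sets (induced X) = induced_sets X"
proof -
  have "sigma_algebra (points X) (induced_sets X)"
    unfolding sigma_algebra_iff2
  proof (intro conjI allI impI ballI)
    fix A assume A: "A \<in> induced_sets X"
    have "Y -` (points X - A) = space B_Omega - Y -` A" if "Y \<in> adm X" for Y
      using that assms unfolding quasi_universal_def by (simp, blast)
    then show "points X - A \<in> induced_sets X"
      using A by (auto simp: induced_sets_def simp del: space_universal)
  next
    fix A :: "nat \<Rightarrow> 'a set" assume "range A \<subseteq> induced_sets X"
    then show "(\<Union>i. A i) \<in> induced_sets X"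
      by (auto simp: induced_sets_def vimage_UN intro!: sets.countable_UN)
  qed (auto simp: induced_sets_def)
  then show ?thesis
    unfolding induced_def by (rule sigma_algebra.sets_measure_of_eq)
qed

abbreviation push :: "'a qspace \<Rightarrow> (omega \<Rightarrow> 'a) \<Rightarrow> omega measure \<Rightarrow> 'a measure" where
  "push X Y \<mu> \<equiv> distr \<mu> (induced X) Y"

abbreviation B_Omega2 :: "(omega \<times> omega) set set" where
  "B_Omega2 \<equiv> sets (induced (prod_qspace Omega Omega))"

definition Q_points :: "omega measure set" where
  "Q_points =
     {\<mu>\<in>G_Omega. \<forall>D\<in>B_Omega2. (\<lambda>\<omega>. emeasure \<mu> (Pair \<omega> -` D)) \<in> borel_measurable B_Omega}"

definition Q_Omega :: "omega measure qspace" where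
  "Q_Omega =
     QSpace Q_points
       {\<kappa>. range \<kappa> \<subseteq> Q_points \<and>
           (\<forall>\<Phi>\<in>adm Omega. \<forall>D\<in>B_Omega2.
              (\<lambda>\<omega>. emeasure (\<kappa> (\<Phi> \<omega>)) (Pair \<omega> -` D)) \<in> borel_measurable B_Omega)}"

definition K_space :: "'a qspace \<Rightarrow> 'a measure qspace" where
  "K_space X =
     QSpace {push X Y \<mu> | Y \<mu>. Y \<in> adm X \<and> \<mu> \<in> points Q_Omega}
       {\<lambda>\<omega>. push X (Z \<omega>) (\<kappa> \<omega>) | Z \<kappa>. Z \<in> adm (rv_qspace X) \<and> \<kappa> \<in> adm Q_Omega}"

definition R_space :: "'a qspace \<Rightarrow> 'a measure qspace" where
  "R_space X =
     QSpace {push X Y \<mu> | Y \<mu>. Y \<in> adm X \<and> \<mu> \<in> points Q_Omega}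
       {\<lambda>\<omega>. push X Y (\<kappa> \<omega>) | Y \<kappa>. Y \<in> adm X \<and> \<kappa> \<in> adm Q_Omega}"

definition P_space :: "'a qspace \<Rightarrow> 'a measure qspace" where
  "P_space X =
     QSpace {push X Y P | Y P. Y \<in> adm X \<and> P \<in> G_Omega}
       {\<lambda>\<omega>. push X (Z \<omega>) P | Z P. Z \<in> adm (rv_qspace X) \<and> P \<in> G_Omega}"

definition S_space :: "'a qspace \<Rightarrow> 'a measure qspace" where
  "S_space X =
     QSpace {push X Y P | Y P. Y \<in> adm X \<and> P \<in> G_Omega}
       {\<lambda>\<omega>. push X Y (distr P B_Omega (\<phi> \<omega>)) | Y \<phi> P.
          Y \<in> adm X \<and> \<phi> \<in> adm (rv_qspace Omega) \<and> P \<in> G_Omega}"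

definition borel_isomorphism :: "('a::topological_space \<Rightarrow> 'b::topological_space) \<Rightarrow> bool" where
  "borel_isomorphism h \<longleftrightarrow>
     bij h \<and> h \<in> borel \<rightarrow>\<^sub>M borel \<and> inv h \<in> borel \<rightarrow>\<^sub>M borel"

text \<open>Universally measurable subsets of \<open>[0,1]\<close> are Lebesgue measurable, so pushing forward
  Lebesgue measure (rather than its restriction to Borel sets) gives the unique extension of the
  uniform distribution to them.\<close>

definition uniform_I :: "unit_interval measure" where
  "uniform_I = distr (restrict_space lebesgue {0..1}) (universal borel) Abs_unit_interval"

definition uniform_Omega :: "(unit_interval \<Rightarrow> omega) \<Rightarrow> omega measure" where
  "uniform_Omega h = distr uniform_I B_Omega h"

end

theory Submission
  imports Defs
begin

text \<open>A universally measurable set lies between two Borel sets of equal measure, for each probability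
  measure separately. Fubini then shows that every probability measure on \<open>\<Omega>\<close> belongs to \<open>Q(\<Omega>)\<close>, so the
  inclusions \<open>S \<subseteq> P \<subseteq> K\<close> are formal. For \<open>K \<subseteq> R\<close>, a random variable \<open>Z\<close> in \<open>(X\<^sup>\<Omega>)\<^sup>\<Omega>\<close> is evaluated at
  pairs coded by interleaving coordinates: the measure \<open>Z(\<omega>)\<^sub>\<star>\<kappa>(\<omega>)\<close> is the push-forward, under one fixed
  admissible map, of the law of the code of \<open>(\<omega>, \<omega>')\<close> for \<open>\<omega>'\<close> distributed as \<open>\<kappa>(\<omega>)\<close>. For \<open>R \<subseteq> S\<close>, every
  kernel is \<open>\<phi>(\<omega>)\<^sub>\<star>\<nu>\<close> for the uniform \<open>\<nu>\<close>: embed \<open>\<Omega>\<close> into the line by a Borel map with a Borel left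
  inverse and use quantile functions.\<close>

section \<open>Universally measurable sets\<close>

text \<open>A set of the completion is a measurable set plus part of a null set; adjoining that
  whole null set gives the outer bound. This is how universally measurable sets are handled below,
  one measure at a time.\<close>

lemma sets_completion_sandwich:
  assumes "A \<in> sets (completion M)"
  obtains B C where "B \<in> sets M" "C \<in> sets M" "B \<subseteq> A" "A \<subseteq> C" "C - B \<in> null_sets M"
proof -
  obtain S N N' where *: "A = S \<union> N" "N \<subseteq> N'" "N' \<in> null_sets M" "S \<in> sets M"
    using assms by (rule sets_completionE)
  have "S \<union> N' - S \<in> null_sets M"
    using * by (intro null_sets_subset[OF *(3)]) auto
  then show thesis
    using * by (intro that[of S "S \<union> N'"]) auto
qed

lemma sets_universalI:
  assumes "A \<subseteq> space M"
    and "\<And>\<mu>. \<lbrakk>prob_space \<mu>; sets \<mu> = sets M\<rbrakk> \<Longrightarrow> A \<in> sets (completion \<mu>)"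
  shows "A \<in> sets (universal M)"
  using assms by (auto simp: sets_universal universally_measurable_sets_def space_prob_algebra)

lemma sets_universalD:
  assumes "A \<in> sets (universal M)" "prob_space \<mu>" "sets \<mu> = sets M"
  shows "A \<in> sets (completion \<mu>)"
  using assms by (auto simp: sets_universal universally_measurable_sets_def space_prob_algebra)

lemma sets_universal_superset: "sets M \<subseteq> sets (universal M)"
  by (auto intro!: sets_universalI dest: sets.sets_into_space)

lemma measurable_universal1:
  assumes "f \<in> M \<rightarrow>\<^sub>M N"
  shows "f \<in> universal M \<rightarrow>\<^sub>M N"
  using assms sets_universal_superset[of M] by (auto simp: measurable_def)

text \<open>For each \<open>\<mu>\<close>, the law of \<open>f\<close> under the completion of
  \<open>\<mu>\<close> is a probability measure on \<open>N\<close>, so \<open>A\<close> lies in the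
  completion of that law. Preimages of its null sets are null, so the preimage of \<open>A\<close>
  lies in the completion of \<open>\<mu>\<close>.\<close>

lemma measurable_universal_iff:
  "f \<in> universal M \<rightarrow>\<^sub>M universal N \<longleftrightarrow> f \<in> universal M \<rightarrow>\<^sub>M N"
proof
  assume "f \<in> universal M \<rightarrow>\<^sub>M universal N"
  then show "f \<in> universal M \<rightarrow>\<^sub>M N"
    using sets_universal_superset[of N] by (auto simp: measurable_def)
next
  assume f: "f \<in> universal M \<rightarrow>\<^sub>M N"
  show "f \<in> universal M \<rightarrow>\<^sub>M universal N"
  proof (rule measurableI)
    fix A assume A: "A \<in> sets (universal N)"
    show "f -` A \<inter> space (universal M) \<in> sets (universal M)"
    proof (rule sets_universalI)
      fix \<mu> assume \<mu>: "prob_space \<mu>" "sets \<mu> = sets M"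
      have sp: "space \<mu> = space M"
        using \<mu>(2) by (rule sets_eq_imp_space_eq)
      interpret c: prob_space "completion \<mu>"
        using \<mu>(1) by (simp add: prob_space.emeasure_space_1 prob_spaceI)
      have fc: "f \<in> completion \<mu> \<rightarrow>\<^sub>M N"
      proof (rule measurableI)
        fix A assume "A \<in> sets N"
        then have "f -` A \<inter> space M \<in> sets (universal M)"
          using measurable_sets[OF f] by simp
        then show "f -` A \<inter> space (completion \<mu>) \<in> sets (completion \<mu>)"
          using \<mu> by (simp add: sp sets_universalD)
      qed (use measurable_space[OF f] in \<open>simp add: sp\<close>)
      have "f \<in> completion \<mu> \<rightarrow>\<^sub>M completion (distr (completion \<mu>) N f)"
        using fc by (intro completion.measurable_completion2) (auto cong: distr_cong)
      moreover have "A \<in> sets (completion (distr (completion \<mu>) N f))"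
        using A fc by (intro sets_universalD[of A N]) (auto intro: c.prob_space_distr)
      ultimately show "f -` A \<inter> space (universal M) \<in> sets (completion \<mu>)"
        by (auto simp: sp dest: measurable_sets)
    qed auto
  qed (use f in \<open>auto dest: measurable_space\<close>)
qed

text \<open>Here \<open>distr P M id\<close> is the restriction of \<open>P\<close> to the smaller
  \<sigma>-algebra of \<open>M\<close>, the measure to which the sandwich applies.\<close>

lemma prob_algebra_universal_restrict:
  assumes "P \<in> space (prob_algebra (universal M))"
  shows "prob_space (distr P M id)" "sets (distr P M id) = sets M" "space P = space M"
    and "A \<in> sets M \<Longrightarrow> emeasure (distr P M id) A = emeasure P A"
proof -
  have P: "prob_space P" "sets P = sets (universal M)"
    using assms by (auto simp: space_prob_algebra)
  show sp: "space P = space M"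
    using P(2) by (auto dest: sets_eq_imp_space_eq)
  have id: "id \<in> P \<rightarrow>\<^sub>M M"
    using measurable_universal1[OF measurable_id[of M]] by (simp add: measurable_cong_sets[OF P(2) refl])
  show "prob_space (distr P M id)"
    using P(1) id by (rule prob_space.prob_space_distr)
  show "A \<in> sets M \<Longrightarrow> emeasure (distr P M id) A = emeasure P A"
    using id sp by (auto simp: emeasure_distr Int_absorb2 dest: sets.sets_into_space)
qed simp

text \<open>Sandwich \<open>A\<close> with respect to the restriction of \<open>P\<close>. The gap
  \<open>C - B\<close> belongs to \<open>M\<close>, so by \<open>eq\<close> it is null for
  \<open>Q\<close> too, and both measures give \<open>A\<close> the value of
  \<open>B\<close>.\<close>

lemma prob_algebra_universal_eqI:
  assumes P: "P \<in> space (prob_algebra (universal M))"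
    and Q: "Q \<in> space (prob_algebra (universal M))"
    and eq: "\<And>A. A \<in> sets M \<Longrightarrow> emeasure P A = emeasure Q A"
  shows "P = Q"
proof (rule measure_eqI)
  have sP: "sets P = sets (universal M)" and sQ: "sets Q = sets (universal M)"
    using P Q by (auto simp: space_prob_algebra)
  then show "sets P = sets Q" by simp
  fix A assume "A \<in> sets P"
  then have A: "A \<in> sets (universal M)" using sP by simp
  obtain B C where BC: "B \<in> sets M" "C \<in> sets M" "B \<subseteq> A" "A \<subseteq> C" "C - B \<in> null_sets (distr P M id)"
    using sets_completion_sandwich[OF sets_universalD[OF A
        prob_algebra_universal_restrict(1,2)[OF P]]] by auto
  have null: "emeasure P (C - B) = 0" "emeasure Q (C - B) = 0"
    using BC eq[of "C - B"] prob_algebra_universal_restrict(4)[OF P, of "C - B"] by auto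
  have "emeasure R A = emeasure R B"
    if "sets R = sets (universal M)" "emeasure R (C - B) = 0" for R
  proof -
    have meas: "B \<in> sets R" "C - B \<in> sets R" "A - B \<in> sets R"
      using BC A that(1) sets_universal_superset[of M] by auto
    then have "A - B \<in> null_sets R"
      using BC(4) by (intro null_sets_subset[OF null_setsI[OF that(2)]]) auto
    then have "emeasure R (B \<union> (A - B)) = emeasure R B"
      using meas by (intro emeasure_Un_null_set)
    also have "B \<union> (A - B) = A" using BC by auto
    finally show ?thesis .
  qed
  then show "emeasure P A = emeasure Q A"
    using null sP sQ eq[OF BC(1)] by metis
qed

text \<open>The measurable version \<open>g\<close> may depend on \<open>\<mu>\<close>: the
  preimages under \<open>f\<close> and \<open>g\<close> differ by a \<open>\<mu>\<close>-null set,
  which the completion of \<open>\<mu>\<close> absorbs.\<close>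

lemma measurable_universal_AE:
  assumes "\<And>\<mu>. \<lbrakk>prob_space \<mu>; sets \<mu> = sets M\<rbrakk> \<Longrightarrow> \<exists>g\<in>M \<rightarrow>\<^sub>M N. AE x in \<mu>. f x = g x"
    and "f \<in> space M \<rightarrow> space N"
  shows "f \<in> universal M \<rightarrow>\<^sub>M N"
proof (rule measurableI)
  fix A assume A: "A \<in> sets N"
  show "f -` A \<inter> space (universal M) \<in> sets (universal M)"
  proof (rule sets_universalI)
    fix \<mu> assume \<mu>: "prob_space \<mu>" "sets \<mu> = sets M"
    have sp: "space \<mu> = space M"
      using \<mu>(2) by (rule sets_eq_imp_space_eq)
    obtain g where g: "g \<in> M \<rightarrow>\<^sub>M N" "AE x in \<mu>. f x = g x"
      using assms(1)[OF \<mu>] by blast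
    show "f -` A \<inter> space (universal M) \<in> sets (completion \<mu>)"
    proof (rule completion.in_sets_AE)
      show "AE x in completion \<mu>. x \<in> g -` A \<inter> space M \<longleftrightarrow> x \<in> f -` A \<inter> space (universal M)"
        using AE_completion[OF g(2)] by eventually_elim auto
      show "g -` A \<inter> space M \<in> sets (completion \<mu>)"
        using g(1) A \<mu>(2) by (intro sets_completionI_sets) (auto dest: measurable_sets)
    qed (auto simp: sp)
  qed auto
qed (use assms(2) in auto)

section \<open>The Hilbert cube\<close>

lemma open_unit_interval_vimage:
  fixes U :: "unit_interval set"
  assumes "open U"
  obtains V where "open V" "U = Rep_unit_interval -` V"
proof -
  have "\<exists>e>0. \<forall>y. dist y x < e \<longrightarrow> y \<in> U" if "x \<in> U" for x
    using assms that by (auto simp: open_dist)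
  then obtain e where e: "\<And>x. x \<in> U \<Longrightarrow> e x > 0" "\<And>x y. x \<in> U \<Longrightarrow> dist y x < e x \<Longrightarrow> y \<in> U"
    by metis
  let ?V = "\<Union>x\<in>U. ball (Rep_unit_interval x) (e x)"
  show thesis
  proof (rule that)
    show "U = Rep_unit_interval -` ?V"
      using e by (fastforce simp: dist_unit_interval_def dist_commute)
  qed auto
qed

lemma continuous_on_Rep_unit_interval: "continuous_on UNIV Rep_unit_interval"
  by (auto simp: continuous_on_iff dist_unit_interval_def)

text \<open>Second countability of the factor allows measurability into the Hilbert cube to be
  checked coordinate by coordinate.\<close>

instance unit_interval :: second_countable_topology
proof
  obtain B :: "real set set" where B: "countable B" "topological_basis B"
    using ex_countable_basis by auto
  have "topological_basis ((\<lambda>V. Rep_unit_interval -` V) ` B)"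
    unfolding topological_basis_def
  proof (intro conjI allI impI ballI)
    fix U :: "unit_interval set" assume "U \<in> (\<lambda>V. Rep_unit_interval -` V) ` B"
    then show "open U"
      using B(2) continuous_on_Rep_unit_interval
      by (auto simp: topological_basis_open intro!: open_vimage)
  next
    fix U :: "unit_interval set" assume "open U"
    then obtain V where V: "open V" "U = Rep_unit_interval -` V"
      by (rule open_unit_interval_vimage)
    then obtain B' where "B' \<subseteq> B" "\<Union>B' = V"
      using B(2) by (metis topological_basis_def)
    then show "\<exists>B'\<subseteq>(\<lambda>V. Rep_unit_interval -` V) ` B. \<Union>B' = U"
      using V by (intro exI[of _ "(\<lambda>V. Rep_unit_interval -` V) ` B'"]) auto
  qed
  then show "\<exists>B::unit_interval set set. countable B \<and> open = generate_topology B"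
    using B(1) topological_basis_imp_subbasis by blast
qed

lemma measurable_Rep_unit_interval [measurable]: "Rep_unit_interval \<in> borel \<rightarrow>\<^sub>M borel"
  by (rule borel_measurable_continuous_onI[OF continuous_on_Rep_unit_interval])

text \<open>\<open>Abs_unit_interval\<close> is unspecified off [0,1]; clamping first gives a
  continuous left inverse of \<open>Rep_unit_interval\<close> on the whole line.\<close>

definition clamp_unit :: "real \<Rightarrow> unit_interval" where
  "clamp_unit t = Abs_unit_interval (max 0 (min 1 t))"

lemma Rep_clamp_unit: "Rep_unit_interval (clamp_unit t) = max 0 (min 1 t)"
  unfolding clamp_unit_def by (rule Abs_unit_interval_inverse) auto

lemma clamp_unit_Rep [simp]: "clamp_unit (Rep_unit_interval x) = x"
  using Rep_unit_interval[of x] by (auto simp: Rep_clamp_unit simp flip: Rep_unit_interval_inject)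

lemma measurable_clamp_unit [measurable]: "clamp_unit \<in> borel \<rightarrow>\<^sub>M borel"
proof (rule borel_measurable_continuous_onI)
  have "continuous_on UNIV (\<lambda>t::real. max 0 (min 1 t))"
    by (intro continuous_intros)
  then show "continuous_on UNIV clamp_unit"
    by (simp add: continuous_on_iff dist_unit_interval_def Rep_clamp_unit)
qed

subsection \<open>A Borel embedding into the real line\<close>

text \<open>A point is coded by the bits \<open>q \<le> x i\<close> for rational \<open>q\<close>. In base 4 with digits 0 and 1 there are no
  carries, and the parity of \<open>\<lfloor>4\<^sup>n r\<rfloor>\<close> is the \<open>n\<close>-th digit.\<close>

definition base4 :: "(nat \<Rightarrow> bool) \<Rightarrow> real" where
  "base4 b = (\<Sum>k. of_bool (b k) / 4 ^ k)"

definition bit4 :: "real \<Rightarrow> nat \<Rightarrow> bool" where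
  "bit4 r n \<longleftrightarrow> odd \<lfloor>4 ^ n * r\<rfloor>"

lemma summable_base4: "summable (\<lambda>k. of_bool (b k) / 4 ^ k :: real)"
proof (rule summable_comparison_test')
  show "summable (\<lambda>k. (1/4) ^ k :: real)" by (rule summable_geometric) auto
qed (auto simp: power_one_over)

lemma base4_bounds: "0 \<le> base4 b" "base4 b \<le> 4/3"
proof -
  show "0 \<le> base4 b"
    unfolding base4_def by (intro suminf_nonneg summable_base4) auto
  have "base4 b \<le> (\<Sum>k. (1/4) ^ k)"
    unfolding base4_def by (intro suminf_le summable_base4 summable_geometric) (auto simp: power_one_over)
  also have "\<dots> = 4/3" by (subst suminf_geometric) auto
  finally show "base4 b \<le> 4/3" .
qed

lemma base4_Suc: "base4 b = of_bool (b 0) + base4 (\<lambda>k. b (Suc k)) / 4"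
proof -
  have "base4 b = of_bool (b 0) + (\<Sum>k. of_bool (b (Suc k)) / 4 ^ Suc k)"
    unfolding base4_def using suminf_split_head[OF summable_base4[of b]] by simp
  also have "(\<Sum>k. of_bool (b (Suc k)) / 4 ^ Suc k :: real) = base4 (\<lambda>k. b (Suc k)) / 4"
    unfolding base4_def by (subst suminf_divide[OF summable_base4, symmetric]) (simp add: mult.commute)
  finally show ?thesis .
qed

text \<open>By \<open>base4_bounds\<close> the tail in \<open>base4_Suc\<close> is at most 1/3, so
  the integer part is the first digit. For later digits, the first one contributes a multiple of 4
  to the floor and leaves its parity alone.\<close>

lemma bit4_base4: "bit4 (base4 b) n = b n"
proof (induction n arbitrary: b)
  case 0
  have "\<lfloor>base4 b\<rfloor> = of_bool (b 0)"
    using base4_bounds[of "\<lambda>k. b (Suc k)"] by (intro floor_unique) (auto simp: base4_Suc[of b])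
  then show ?case by (simp add: bit4_def)
next
  case (Suc n)
  have "4 ^ Suc n * base4 b = 4 ^ n * base4 (\<lambda>k. b (Suc k)) + of_int (4 ^ Suc n * of_bool (b 0))"
    by (simp add: base4_Suc[of b] algebra_simps)
  then have "\<lfloor>4 ^ Suc n * base4 b\<rfloor> = \<lfloor>4 ^ n * base4 (\<lambda>k. b (Suc k))\<rfloor> + 4 ^ Suc n * of_bool (b 0)"
    by (metis floor_add_int)
  then show ?case using Suc.IH[of "\<lambda>k. b (Suc k)"] by (simp add: bit4_def)
qed

text \<open>A point is recovered from its rational cut by density. Rationals above \<open>y\<close>
  are replaced by 0, which is harmless because \<open>0 \<le> y\<close>.\<close>

lemma unit_eq_SUP_rational:
  fixes y :: real
  assumes "0 \<le> y" "y \<le> 1" and q: "range q = \<rat> \<inter> {0..1}"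
  shows "(SUP n::nat. if q n \<le> y then q n else 0) = y"
proof (rule antisym)
  show "(SUP n. if q n \<le> y then q n else 0) \<le> y"
    using assms by (intro cSUP_least) auto
  show "y \<le> (SUP n. if q n \<le> y then q n else 0)"
  proof (rule dense_le)
    fix z assume "z < y"
    show "z \<le> (SUP n. if q n \<le> y then q n else 0)"
    \<comment> \<open>A rational between a negative \<open>z\<close> and \<open>y\<close> may lie
      outside [0,1], so this case uses the index of the rational 0 instead.\<close>
    proof (cases "z < 0")
      case True
      have "0 \<in> range q" using q by auto
      then obtain n where n: "q n = 0" by (metis imageE)
      have "0 \<le> (SUP n. if q n \<le> y then q n else 0)"
        using assms n by (intro cSUP_upper2[of _ _ n] bdd_aboveI[of _ y]) auto
      then show ?thesis using True by linarith
    next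
      case False
      obtain r where r: "r \<in> \<rat>" "z < r" "r < y" using Rats_dense_in_real[OF \<open>z < y\<close>] by auto
      then have "r \<in> range q" using q False assms by auto
      then obtain n where "q n = r" by auto
      then show ?thesis using assms r
        by (intro cSUP_upper2[of _ _ n] bdd_aboveI[of _ y]) auto
    qed
  qed
qed

text \<open>\<open>g\<close> stores the rational cuts of all coordinates as one digit sequence,
  indexed through \<open>prod_decode\<close>; \<open>s\<close> reads the digits back and takes
  suprema. Off the range of \<open>g\<close> the digits are arbitrary, but the suprema remain
  bounded by 1, so \<open>s\<close> is Borel everywhere.\<close>

lemma Hilbert_cube_embedding:
  obtains g :: "omega \<Rightarrow> real" and s :: "real \<Rightarrow> omega"
  where "g \<in> borel \<rightarrow>\<^sub>M borel" "s \<in> borel \<rightarrow>\<^sub>M borel" "\<And>x. s (g x) = x"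
proof -
  define q :: "nat \<Rightarrow> real" where "q = from_nat_into (\<rat> \<inter> {0..1})"
  have q: "range q = \<rat> \<inter> {0..1}"
    unfolding q_def by (intro range_from_nat_into) (auto intro!: countable_Int1 countable_rat exI[of _ 0])
  then have q01: "0 \<le> q n" "q n \<le> 1" for n
    by (metis IntE atLeastAtMost_iff rangeI)+
  define g :: "omega \<Rightarrow> real" where
    "g x = base4 (\<lambda>m. q (snd (prod_decode m)) \<le> Rep_unit_interval (x (fst (prod_decode m))))" for x
  define s :: "real \<Rightarrow> omega" where
    "s r i = clamp_unit (SUP n. if bit4 r (prod_encode (i, n)) then q n else 0)" for r i
  show thesis
  proof (rule that)
    have [measurable]: "(\<lambda>x::omega. Rep_unit_interval (x i)) \<in> borel \<rightarrow>\<^sub>M borel" for i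
      by (rule measurable_compose[OF measurable_product_coordinates measurable_Rep_unit_interval])
    show "g \<in> borel \<rightarrow>\<^sub>M borel"
      unfolding g_def base4_def by measurable
    have [measurable]: "Measurable.pred borel (\<lambda>r. bit4 r n)" for n
      unfolding bit4_def by measurable
    show "s \<in> borel \<rightarrow>\<^sub>M borel"
      unfolding s_def
      by (intro measurable_coordinatewise_then_product measurable_compose[OF _ measurable_clamp_unit]
          borel_measurable_cSUP) (auto intro!: bdd_aboveI[of _ 1] q01)
    fix x
    have "s (g x) i = x i" for i
    proof -
      have "s (g x) i = clamp_unit (SUP n. if q n \<le> Rep_unit_interval (x i) then q n else 0)"
        by (simp only: s_def g_def bit4_base4 prod_encode_inverse fst_conv snd_conv)
      also have "(SUP n. if q n \<le> Rep_unit_interval (x i) then q n else 0) = Rep_unit_interval (x i)"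
        using Rep_unit_interval[of "x i"] by (intro unit_eq_SUP_rational q) auto
      finally show ?thesis by simp
    qed
    then show "s (g x) = x" by auto
  qed
qed

subsection \<open>Interleaving\<close>

text \<open>A Borel pairing of the cube with itself, decoded by \<open>evens\<close> and
  \<open>odds\<close>. It turns statements about two sample points into statements about admissible
  maps of one.\<close>

definition interleave :: "omega \<Rightarrow> omega \<Rightarrow> omega" where
  "interleave x y n = (if even n then x (n div 2) else y (n div 2))"

definition evens :: "omega \<Rightarrow> omega" where "evens x n = x (2 * n)"

definition odds :: "omega \<Rightarrow> omega" where "odds x n = x (2 * n + 1)"

lemma interleave_evens_odds [simp]:
  "evens (interleave x y) = x" "odds (interleave x y) = y"
  by (auto simp: evens_def odds_def interleave_def)

lemma measurable_interleave [measurable (raw)]: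
  fixes f g :: "'a \<Rightarrow> omega"
  assumes "f \<in> M \<rightarrow>\<^sub>M borel" "g \<in> M \<rightarrow>\<^sub>M borel"
  shows "(\<lambda>x. interleave (f x) (g x)) \<in> M \<rightarrow>\<^sub>M borel"
proof (rule measurable_coordinatewise_then_product)
  fix n
  show "(\<lambda>x. interleave (f x) (g x) n) \<in> M \<rightarrow>\<^sub>M borel"
    using assms[THEN measurable_product_then_coordinatewise, of "n div 2"]
    by (simp add: interleave_def)
qed

lemma measurable_evens: "evens \<in> borel \<rightarrow>\<^sub>M borel"
  unfolding evens_def by (intro measurable_coordinatewise_then_product measurable_product_coordinates)

lemma measurable_odds: "odds \<in> borel \<rightarrow>\<^sub>M borel"
  unfolding odds_def by (intro measurable_coordinatewise_then_product measurable_product_coordinates)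

section \<open>Quasi-universal spaces of random variables\<close>

lemma adm_Omega: "adm Omega = (B_Omega \<rightarrow>\<^sub>M B_Omega)"
  by (simp add: Omega_def)

lemma adm_Omega_iff: "U \<in> adm Omega \<longleftrightarrow> U \<in> B_Omega \<rightarrow>\<^sub>M borel"
  by (simp add: adm_Omega measurable_universal_iff)

lemma adm_OmegaI: "U \<in> borel \<rightarrow>\<^sub>M borel \<Longrightarrow> U \<in> adm Omega"
  by (simp add: adm_Omega_iff measurable_universal1)

lemma id_adm_Omega: "(\<lambda>\<omega>. \<omega>) \<in> adm Omega" and const_adm_Omega: "(\<lambda>_. c) \<in> adm Omega"
  by (auto simp: adm_Omega)

lemma quasi_universal_Omega: "quasi_universal Omega"
  by (auto simp: quasi_universal_def Omega_def)

text \<open>The product is quasi-universal, so \<open>sets_induced\<close> identifies its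
  \<sigma>-algebra; its admissible variables are pairs of admissible maps.\<close>

lemma mem_B_Omega2_iff:
  "D \<in> B_Omega2 \<longleftrightarrow> (\<forall>U\<in>adm Omega. \<forall>V\<in>adm Omega. {\<omega>. (U \<omega>, V \<omega>) \<in> D} \<in> sets B_Omega)"
proof -
  have "quasi_universal (prod_qspace Omega Omega)"
    unfolding quasi_universal_def
  proof (intro conjI ballI)
    fix Y \<Phi> assume "Y \<in> adm (prod_qspace Omega Omega)" "\<Phi> \<in> adm Omega"
    then obtain U V where "Y = (\<lambda>\<omega>. (U \<omega>, V \<omega>))" "U \<circ> \<Phi> \<in> adm Omega" "V \<circ> \<Phi> \<in> adm Omega"
      by (auto simp: prod_qspace_def adm_Omega intro: measurable_comp)
    then show "Y \<circ> \<Phi> \<in> adm (prod_qspace Omega Omega)"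
      by (force simp: prod_qspace_def o_def)
  qed (use const_adm_Omega in \<open>force simp: prod_qspace_def Omega_def\<close>)+
  then show ?thesis
    by (auto simp: sets_induced induced_sets_def prod_qspace_def Omega_def vimage_def)
qed

lemma B_Omega2_section:
  assumes "D \<in> B_Omega2"
  shows "Pair \<omega> -` D \<in> sets B_Omega"
  using assms[unfolded mem_B_Omega2_iff, rule_format, OF const_adm_Omega[of \<omega>] id_adm_Omega]
  by (simp add: vimage_def)

lemma adm_in_points: "quasi_universal X \<Longrightarrow> Y \<in> adm X \<Longrightarrow> Y \<omega> \<in> points X"
  by (auto simp: quasi_universal_def)

lemma adm_const: "quasi_universal X \<Longrightarrow> x \<in> points X \<Longrightarrow> (\<lambda>_. x) \<in> adm X"
  by (auto simp: quasi_universal_def)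

lemma adm_comp: "quasi_universal X \<Longrightarrow> Y \<in> adm X \<Longrightarrow> U \<in> adm Omega \<Longrightarrow> (\<lambda>\<omega>. Y (U \<omega>)) \<in> adm X"
  by (auto simp: quasi_universal_def o_def)

lemma adm_measurable:
  assumes "quasi_universal X" "Y \<in> adm X"
  shows "Y \<in> B_Omega \<rightarrow>\<^sub>M induced X"
  using assms by (intro measurableI) (auto simp: sets_induced induced_sets_def adm_in_points)

text \<open>Joint admissibility is the composition of the uncurried \<open>Z\<close> with a pair of
  admissible maps. The condition \<open>range Z \<subseteq> adm X\<close> is recovered from a
  constant \<open>U\<close> and the identity \<open>V\<close>.\<close>

lemma adm_rv_iff:
  assumes "quasi_universal X"
  shows "Z \<in> adm (rv_qspace X) \<longleftrightarrow> (\<forall>U\<in>adm Omega. \<forall>V\<in>adm Omega. (\<lambda>\<omega>. Z (U \<omega>) (V \<omega>)) \<in> adm X)"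
    (is "_ \<longleftrightarrow> ?R")
proof
  assume Z: "Z \<in> adm (rv_qspace X)"
  show ?R
  proof (intro ballI)
    fix U V assume "U \<in> adm Omega" "V \<in> adm Omega"
    then have "(\<lambda>\<omega>. (U \<omega>, V \<omega>)) \<in> adm (prod_qspace Omega Omega)"
      by (auto simp: prod_qspace_def)
    then have "(\<lambda>(\<omega>, \<omega>'). Z \<omega> \<omega>') \<circ> (\<lambda>\<omega>. (U \<omega>, V \<omega>)) \<in> adm X"
      using Z unfolding rv_qspace_def quasi_measurable_def by simp
    then show "(\<lambda>\<omega>. Z (U \<omega>) (V \<omega>)) \<in> adm X"
      by (simp add: o_def)
  qed
next
  assume R: ?R
  have "Z c \<in> adm X" for c
    using R[rule_format, OF const_adm_Omega id_adm_Omega] .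
  then show "Z \<in> adm (rv_qspace X)"
    using R by (auto simp: rv_qspace_def quasi_measurable_def prod_qspace_def o_def adm_in_points[OF assms])
qed

lemma adm_rv_apply: "Z \<in> adm (rv_qspace X) \<Longrightarrow> Z \<omega> \<in> adm X"
  by (auto simp: rv_qspace_def)

lemma adm_rv_comp:
  assumes "quasi_universal X" "Y \<in> adm X" "\<phi> \<in> adm (rv_qspace Omega)"
  shows "(\<lambda>\<omega> \<omega>'. Y (\<phi> \<omega> \<omega>')) \<in> adm (rv_qspace X)"
  using assms by (auto simp: adm_rv_iff quasi_universal_Omega intro: adm_comp)

lemma adm_rv_const:
  assumes "quasi_universal X" "Y \<in> adm X"
  shows "(\<lambda>_. Y) \<in> adm (rv_qspace X)"
  using assms by (auto simp: adm_rv_iff intro: adm_comp)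

lemma quasi_universal_rv:
  assumes "quasi_universal X"
  shows "quasi_universal (rv_qspace X)"
  unfolding quasi_universal_def
proof (intro conjI ballI)
  fix Z \<Phi> assume "Z \<in> adm (rv_qspace X)" "\<Phi> \<in> adm Omega"
  then show "Z \<circ> \<Phi> \<in> adm (rv_qspace X)"
    using adm_comp[OF quasi_universal_Omega \<open>\<Phi> \<in> adm Omega\<close>] by (simp add: adm_rv_iff[OF assms])
qed (use adm_rv_const[OF assms] in \<open>auto simp: rv_qspace_def\<close>)

text \<open>Functoriality of push-forwards: it moves a randomization from the measure into the
  random variable, the passage from \<open>S_space\<close> to \<open>P_space\<close>.\<close>

lemma push_distr:
  assumes "quasi_universal X" "Y \<in> adm X" "U \<in> adm Omega" "sets \<mu> = sets B_Omega"
  shows "push X Y (distr \<mu> B_Omega U) = push X (\<lambda>\<omega>. Y (U \<omega>)) \<mu>"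
proof -
  have "U \<in> \<mu> \<rightarrow>\<^sub>M B_Omega"
    using assms(3,4) by (simp add: adm_Omega cong: measurable_cong_sets)
  then show ?thesis
    using adm_measurable[OF assms(1,2)] by (simp add: distr_distr o_def)
qed

lemma distr_G_Omega:
  assumes "P \<in> G_Omega" "U \<in> adm Omega"
  shows "distr P B_Omega U \<in> G_Omega"
  using assms by (auto simp: space_prob_algebra adm_Omega intro!: prob_space.prob_space_distr
      cong: measurable_cong_sets)

section \<open>Kernels on the Hilbert cube\<close>

text \<open>Fubini for \<open>D\<close> between two Borel sets that agree almost everywhere for \<open>\<mu> \<otimes> P\<close>: for almost
  every \<open>\<omega>\<close> the section of \<open>D\<close> has the same measure as that of the inner Borel set.\<close>

lemma measurable_emeasure_section:
  assumes P: "P \<in> G_Omega" and D: "D \<in> B_Omega2"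
  shows "(\<lambda>\<omega>. emeasure P (Pair \<omega> -` D)) \<in> borel_measurable B_Omega"
proof (rule measurable_universal_AE)
  fix \<mu> :: "omega measure" assume \<mu>: "prob_space \<mu>" "sets \<mu> = sets borel"
  define P0 where "P0 = distr P borel id"
  note P0 = prob_algebra_universal_restrict[OF P, folded P0_def]
  have sP: "sets P = sets B_Omega" using P by (simp add: space_prob_algebra)
  interpret \<mu>: prob_space \<mu> by fact
  interpret P0: prob_space P0 by fact
  interpret pair_prob_space \<mu> P0 ..
  have spaces: "space \<mu> = UNIV" "space P0 = UNIV"
    using \<mu>(2) P0(2) by (auto dest: sets_eq_imp_space_eq)
  let ?p = "\<lambda>z. interleave (fst z) (snd z)"
  have p: "?p \<in> \<mu> \<Otimes>\<^sub>M P0 \<rightarrow>\<^sub>M borel"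
    using \<mu>(2) P0(2) by (auto intro!: measurable_interleave simp: measurable_cong_sets[OF \<mu>(2) refl]
        intro: measurable_compose[OF measurable_fst] measurable_compose[OF measurable_snd])
  \<comment> \<open>\<open>D\<close> is known only through pairs of admissible maps, so it is
    decoded along \<open>evens\<close> and \<open>odds\<close>; the sandwich is taken for the law
    \<open>\<rho>\<close> of the coded pair.\<close>
  define \<rho> where "\<rho> = distr (\<mu> \<Otimes>\<^sub>M P0) borel ?p"
  let ?D = "{\<omega>. (evens \<omega>, odds \<omega>) \<in> D}"
  have "?D \<in> sets B_Omega"
    using D measurable_evens measurable_odds by (auto simp: mem_B_Omega2_iff adm_OmegaI)
  then have "?D \<in> sets (completion \<rho>)"
    by (rule sets_universalD) (auto simp: \<rho>_def intro!: prob_space_distr p)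
  then obtain B C where BC: "B \<in> sets \<rho>" "C \<in> sets \<rho>" "B \<subseteq> ?D" "?D \<subseteq> C" "C - B \<in> null_sets \<rho>"
    by (rule sets_completion_sandwich)
  have BC': "B \<in> sets borel" "C \<in> sets borel" using BC by (auto simp: \<rho>_def)
  have "AE z in \<mu> \<Otimes>\<^sub>M P0. ?p z \<notin> C - B"
    using AE_not_in[OF BC(5)] BC' unfolding \<rho>_def by (subst (asm) AE_distr_iff[OF p]) auto
  from AE_pair[OF this] have ae: "AE x in \<mu>. AE y in P0. interleave x y \<notin> C - B"
    by simp
  have sect: "{y. interleave x y \<in> S} \<in> sets borel" if "S \<in> sets borel" for x S
    using measurable_sets[OF measurable_interleave[OF measurable_const measurable_ident_sets[OF refl]] that, of x]
    by (simp add: vimage_def)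
  show "\<exists>g\<in>borel \<rightarrow>\<^sub>M borel. AE x in \<mu>. emeasure P (Pair x -` D) = g x"
  proof (intro bexI)
    show "(\<lambda>x. emeasure P0 {y. interleave x y \<in> B}) \<in> borel \<rightarrow>\<^sub>M borel"
      using P0.measurable_emeasure_Pair[OF measurable_sets[OF p BC'(1)]]
      by (simp add: measurable_cong_sets[OF \<mu>(2) refl] spaces space_pair_measure vimage_def)
    show "AE x in \<mu>. emeasure P (Pair x -` D) = emeasure P0 {y. interleave x y \<in> B}"
      using ae
    proof eventually_elim
      case (elim x)
      let ?B = "{y. interleave x y \<in> B}" and ?C = "{y. interleave x y \<in> C}"
      have CB: "?C - ?B \<in> sets borel"
        using sect BC' by (intro sets.Diff)
      have "?C - ?B = {y. interleave x y \<in> C - B}" by auto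
      then have "emeasure P0 (?C - ?B) = 0"
        using elim CB P0(2)
        by (subst (asm) AE_iff_measurable[where N="?C - ?B"]) (auto simp: spaces)
      then have null: "?C - ?B \<in> null_sets P"
        using P0(4)[OF CB] CB sP sets_universal_superset[of borel] by (auto intro!: null_setsI)
      have sub: "?B \<subseteq> Pair x -` D" "Pair x -` D \<subseteq> ?C"
        using BC(3,4) by (auto dest!: subsetD)
      have "Pair x -` D - ?B \<in> null_sets P"
        using B_Omega2_section[OF D, of x] sect[OF BC'(1), of x] sets_universal_superset[of borel] sub
        by (intro null_sets_subset[OF null]) (auto simp: sP)
      then have "emeasure P (?B \<union> (Pair x -` D - ?B)) = emeasure P ?B"
        using sect[OF BC'(1), of x] sets_universal_superset[of borel]
        by (intro emeasure_Un_null_set) (auto simp: sP)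
      moreover have "?B \<union> (Pair x -` D - ?B) = Pair x -` D"
        using sub by auto
      ultimately show ?case
        using P0(4)[OF sect[OF BC'(1)]] by simp
    qed
  qed
qed auto

section \<open>Admissible kernels, quantile functions and randomization\<close>

lemma Q_points_eq_G_Omega: "Q_points = G_Omega"
  using measurable_emeasure_section by (auto simp: Q_points_def)

lemma const_adm_Q_Omega:
  assumes "P \<in> G_Omega"
  shows "(\<lambda>_. P) \<in> adm Q_Omega"
  using assms measurable_emeasure_section by (auto simp: Q_Omega_def Q_points_eq_G_Omega)

text \<open>Take the identity for \<open>\<Phi>\<close> and a cylinder
  \<open>UNIV \<times> A\<close>, all of whose sections equal \<open>A\<close>.\<close>

lemma adm_Q_Omega_kernel:
  assumes "\<kappa> \<in> adm Q_Omega" "A \<in> sets borel"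
  shows "(\<lambda>\<omega>. emeasure (\<kappa> \<omega>) A) \<in> borel_measurable B_Omega"
proof -
  have "UNIV \<times> A \<in> B_Omega2"
    using assms(2) by (auto simp: mem_B_Omega2_iff adm_Omega_iff dest!: measurable_sets[of _ _ _ A])
      (simp add: vimage_def)
  then show ?thesis
    using assms(1) id_adm_Omega by (fastforce simp: Q_Omega_def vimage_def)
qed

text \<open>For \<open>0 < v < 1\<close>, the infimum is at most \<open>t\<close> exactly when
  \<open>v \<le> cdf (\<kappa> \<omega>) t\<close>, so a sublevel set involves the cdf at one fixed
  \<open>t\<close> only. Elsewhere the set of such \<open>t\<close> may be empty or unbounded below,
  hence the default 0.\<close>

lemma measurable_quantile:
  assumes cdf: "\<And>t. (\<lambda>\<omega>. cdf (\<kappa> \<omega>) t) \<in> borel_measurable M"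
    and \<kappa>: "\<And>\<omega>. real_distribution (\<kappa> \<omega>)"
  shows "(\<lambda>(\<omega>, v). if 0 < v \<and> v < 1 then Inf {t. v \<le> cdf (\<kappa> \<omega>) t} else 0)
    \<in> borel_measurable (M \<Otimes>\<^sub>M borel)"
proof (rule borel_measurableI_le)
  fix t :: real
  have eq: "Inf {t. v \<le> cdf (\<kappa> \<omega>) t} \<le> t \<longleftrightarrow> v \<le> cdf (\<kappa> \<omega>) t" if "0 < v" "v < 1" for \<omega> v
  proof -
    interpret cdf_distribution "\<kappa> \<omega>" by (rule cdf_distribution.intro[OF \<kappa>])
    show ?thesis by (rule pseudoinverse[OF that, symmetric])
  qed
  have F: "(\<lambda>z. cdf (\<kappa> (fst z)) t) \<in> borel_measurable (M \<Otimes>\<^sub>M borel)"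
    by (rule measurable_compose[OF measurable_fst cdf])
  have "{z \<in> space N. 0 < G z \<and> G z < 1 \<and> G z \<le> F z \<or> \<not> (0 < G z \<and> G z < 1) \<and> 0 \<le> t} \<in> sets N"
    if [measurable]: "F \<in> borel_measurable N" "G \<in> borel_measurable N"
    for F G :: "'a \<times> real \<Rightarrow> real" and N
    by measurable
  from this[OF F measurable_snd]
  have "{z \<in> space (M \<Otimes>\<^sub>M borel). 0 < snd z \<and> snd z < 1 \<and> snd z \<le> cdf (\<kappa> (fst z)) t \<or>
      \<not> (0 < snd z \<and> snd z < 1) \<and> 0 \<le> t} \<in> sets (M \<Otimes>\<^sub>M borel)" .
  also have "{z \<in> space (M \<Otimes>\<^sub>M borel). 0 < snd z \<and> snd z < 1 \<and> snd z \<le> cdf (\<kappa> (fst z)) t \<or>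
      \<not> (0 < snd z \<and> snd z < 1) \<and> 0 \<le> t}
    = {z \<in> space (M \<Otimes>\<^sub>M borel).
      (case z of (\<omega>, v) \<Rightarrow> if 0 < v \<and> v < 1 then Inf {t. v \<le> cdf (\<kappa> \<omega>) t} else 0) \<le> t}"
    by (auto simp: eq split: if_splits)
  finally show "{z \<in> space (M \<Otimes>\<^sub>M borel).
      (case z of (\<omega>, v) \<Rightarrow> if 0 < v \<and> v < 1 then Inf {t. v \<le> cdf (\<kappa> \<omega>) t} else 0) \<le> t}
    \<in> sets (M \<Otimes>\<^sub>M borel)" .
qed

text \<open>The sample is the image, under the left inverse of a Borel embedding into the line, of the
  quantile function of the embedded kernel evaluated at the uniform variable \<open>u\<close>.\<close>

lemma randomization:
  assumes \<kappa>: "\<kappa> \<in> adm Q_Omega" and \<nu>: "\<nu> \<in> G_Omega" and u: "u \<in> borel \<rightarrow>\<^sub>M borel"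
    and uniform: "\<And>B. B \<in> sets borel \<Longrightarrow> emeasure \<nu> (u -` B) = emeasure lborel (B \<inter> {0..1::real})"
  obtains \<phi> where "\<phi> \<in> adm (rv_qspace Omega)" "\<And>\<omega>. \<kappa> \<omega> = distr \<nu> B_Omega (\<phi> \<omega>)"
proof -
  obtain g :: "omega \<Rightarrow> real" and s where g: "g \<in> borel \<rightarrow>\<^sub>M borel" and s: "s \<in> borel \<rightarrow>\<^sub>M borel"
    and sg: "\<And>x. s (g x) = x"
    using Hilbert_cube_embedding by blast
  have \<kappa>G: "\<kappa> \<omega> \<in> G_Omega" for \<omega>
    using \<kappa> by (auto simp: Q_Omega_def Q_points_eq_G_Omega)
  have \<kappa>_sets: "sets (\<kappa> \<omega>) = sets B_Omega" "space (\<kappa> \<omega>) = UNIV" for \<omega>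
    using \<kappa>G[of \<omega>] by (auto simp: space_prob_algebra dest: sets_eq_imp_space_eq)
  have \<nu>_sets: "sets \<nu> = sets B_Omega" "space \<nu> = UNIV"
    using \<nu> by (auto simp: space_prob_algebra dest: sets_eq_imp_space_eq)
  have g\<kappa>: "g \<in> \<kappa> \<omega> \<rightarrow>\<^sub>M borel" for \<omega>
    using measurable_universal1[OF g] by (simp add: measurable_cong_sets[OF \<kappa>_sets(1) refl])
  define \<eta> where "\<eta> \<omega> = distr (\<kappa> \<omega>) borel g" for \<omega>
  have \<eta>: "real_distribution (\<eta> \<omega>)" for \<omega>
    using \<kappa>G[of \<omega>] g\<kappa>[of \<omega>] unfolding \<eta>_def
    by (auto simp: space_prob_algebra intro!: prob_space.real_distribution_distr)
  have cdf: "(\<lambda>\<omega>. cdf (\<eta> \<omega>) t) \<in> borel_measurable B_Omega" for t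
  proof -
    have "g -` {..t} \<in> sets borel"
      using measurable_sets[OF g, of "{..t}"] by simp
    from adm_Q_Omega_kernel[OF \<kappa> this] show ?thesis
      unfolding cdf_def \<eta>_def measure_def
      by (subst emeasure_distr[OF g\<kappa>]) (auto simp: \<kappa>_sets)
  qed
  define q where "q \<omega> v = (if 0 < v \<and> v < 1 then Inf {t. v \<le> cdf (\<eta> \<omega>) t} else 0)" for \<omega> v
  have q: "(\<lambda>z. q (fst z) (snd z)) \<in> borel_measurable (B_Omega \<Otimes>\<^sub>M borel)"
    using measurable_quantile[of \<eta> B_Omega, OF cdf \<eta>] by (simp add: q_def case_prod_beta' cong: if_cong)
  have q1: "q \<omega> \<in> borel_measurable borel" for \<omega>
    using measurable_compose[OF measurable_Pair1' q, of \<omega>] by simp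
  define \<phi> where "\<phi> \<omega> \<omega>' = s (q \<omega> (u \<omega>'))" for \<omega> \<omega>'
  have \<phi>: "\<phi> \<in> adm (rv_qspace Omega)"
    unfolding adm_rv_iff[OF quasi_universal_Omega]
  proof (intro ballI)
    fix U V assume "U \<in> adm Omega" "V \<in> adm Omega"
    then have "U \<in> B_Omega \<rightarrow>\<^sub>M B_Omega" "V \<in> B_Omega \<rightarrow>\<^sub>M borel"
      by (simp_all only: adm_Omega_iff flip: adm_Omega)
    then have "(\<lambda>\<omega>. (U \<omega>, u (V \<omega>))) \<in> B_Omega \<rightarrow>\<^sub>M B_Omega \<Otimes>\<^sub>M borel"
      by (rule measurable_Pair[OF _ measurable_compose[OF _ u]])
    from measurable_compose[OF measurable_compose[OF this q] s]
    show "(\<lambda>\<omega>. \<phi> (U \<omega>) (V \<omega>)) \<in> adm Omega"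
      by (simp add: adm_Omega_iff \<phi>_def)
  qed
  moreover have "\<kappa> \<omega> = distr \<nu> B_Omega (\<phi> \<omega>)" for \<omega>
  proof (rule prob_algebra_universal_eqI[OF \<kappa>G])
    show "distr \<nu> B_Omega (\<phi> \<omega>) \<in> G_Omega"
      using \<nu> adm_rv_apply[OF \<phi>] by (rule distr_G_Omega)
    \<comment> \<open>Both measures live on the universally measurable sets, but agreement on Borel
      sets suffices.\<close>
    fix A :: "omega set" assume A: "A \<in> sets borel"
    have sA: "s -` A \<in> sets borel"
      using measurable_sets[OF s A] by simp
    have qA: "q \<omega> -` s -` A \<in> sets borel"
      using measurable_sets[OF q1 sA] by simp
    interpret cdf_distribution "\<eta> \<omega>" by (rule cdf_distribution.intro[OF \<eta>])
    let ?I = "\<lambda>v. Inf {t. v \<le> cdf (\<eta> \<omega>) t}"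
    have I: "?I \<in> restrict_space lborel {0<..<1} \<rightarrow>\<^sub>M borel"
      using measurable_CI by (simp add: measurable_def sets_restrict_space space_restrict_space)
    have "emeasure (\<kappa> \<omega>) A = emeasure (\<eta> \<omega>) (s -` A)"
      unfolding \<eta>_def by (subst emeasure_distr[OF g\<kappa> sA]) (simp add: \<kappa>_sets vimage_def sg)
    \<comment> \<open>The quantile function carries Lebesgue measure on the open unit interval to
      \<open>\<eta> \<omega>\<close>.\<close>
    also have "\<dots> = emeasure (distr (restrict_space lborel {0<..<1}) borel ?I) (s -` A)"
      by (simp only: distr_I_eq_M)
    also have "\<dots> = emeasure (restrict_space lborel {0<..<1}) (?I -` s -` A \<inter> {0<..<1})"
      by (subst emeasure_distr[OF I sA]) (simp add: space_restrict_space)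
    also have "\<dots> = emeasure lborel (?I -` s -` A \<inter> {0<..<1})"
      by (subst emeasure_restrict_space) auto
    also have "?I -` s -` A \<inter> {0<..<1} = q \<omega> -` s -` A \<inter> {0<..<1}"
      by (auto simp: q_def)
    \<comment> \<open>The endpoints, where \<open>q\<close> takes its default value, form a Lebesgue
      null set.\<close>
    also have "emeasure lborel \<dots> = emeasure lborel (q \<omega> -` s -` A \<inter> {0..1})"
    proof (rule emeasure_eq_AE)
      show "AE v in lborel. v \<in> q \<omega> -` s -` A \<inter> {0<..<1} \<longleftrightarrow> v \<in> q \<omega> -` s -` A \<inter> {0..1}"
        using AE_lborel_singleton[of 0] AE_lborel_singleton[of 1] by eventually_elim auto
    qed (use qA in auto)
    also have "\<dots> = emeasure \<nu> (u -` q \<omega> -` s -` A)"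
      using uniform[OF qA] by simp
    also have "\<dots> = emeasure \<nu> (\<phi> \<omega> -` A)"
      by (simp add: \<phi>_def vimage_def)
    also have "\<dots> = emeasure (distr \<nu> B_Omega (\<phi> \<omega>)) A"
      using adm_rv_apply[OF \<phi>, of \<omega>] A sets_universal_superset[of borel]
      by (subst emeasure_distr) (auto simp: adm_Omega \<nu>_sets measurable_cong_sets[OF \<nu>_sets(1) refl])
    finally show "emeasure (\<kappa> \<omega>) A = emeasure (distr \<nu> B_Omega (\<phi> \<omega>)) A" .
  qed
  ultimately show thesis by (rule that)
qed

section \<open>The uniform distribution\<close>

text \<open>On [0,1] the map agrees with the Borel map \<open>clamp_unit\<close>. Sandwiching
  \<open>A\<close> for the law of \<open>clamp_unit\<close> and pulling back leaves a Lebesgue null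
  gap.\<close>

lemma measurable_Abs_unit_interval:
  "Abs_unit_interval \<in> restrict_space lebesgue {0..1} \<rightarrow>\<^sub>M universal borel"
proof (rule measurableI)
  fix A :: "unit_interval set" assume A: "A \<in> sets (universal borel)"
  define M where "M = restrict_space lborel {0..1::real}"
  have M: "prob_space M"
    by (rule prob_spaceI) (simp add: M_def space_restrict_space emeasure_restrict_space)
  have clamp: "clamp_unit \<in> M \<rightarrow>\<^sub>M borel"
    unfolding M_def by (rule measurable_restrict_space1) simp
  have "A \<in> sets (completion (distr M borel clamp_unit))"
    using A by (rule sets_universalD) (auto intro!: prob_space.prob_space_distr M clamp)
  then obtain B C where BC: "B \<in> sets borel" "C \<in> sets borel" "B \<subseteq> A" "A \<subseteq> C"
    "C - B \<in> null_sets (distr M borel clamp_unit)"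
    by (rule sets_completion_sandwich) auto
  have meas: "clamp_unit -` S \<inter> {0..1} \<in> sets borel" if "S \<in> sets borel" for S
    using measurable_sets[OF measurable_clamp_unit that] by simp
  have "emeasure lborel (clamp_unit -` (C - B) \<inter> {0..1}) = emeasure M (clamp_unit -` (C - B) \<inter> {0..1})"
    unfolding M_def by (subst emeasure_restrict_space) auto
  also have "\<dots> = 0"
    using BC clamp by (simp add: null_sets_def emeasure_distr M_def space_restrict_space)
  finally have null: "clamp_unit -` (C - B) \<inter> {0..1} \<in> null_sets lborel"
    using BC meas by (auto intro!: null_setsI)
  have "clamp_unit -` A \<inter> {0..1} \<in> sets lebesgue"
    by (rule sets_completionI[OF _ _ null, of _ "clamp_unit -` B \<inter> {0..1}" "clamp_unit -` (A - B) \<inter> {0..1}"])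
       (use BC meas in auto)
  moreover have "Abs_unit_interval -` A \<inter> {0..1} = clamp_unit -` A \<inter> {0..1}"
    by (auto simp: clamp_unit_def min_absorb2 max_absorb2)
  ultimately show "Abs_unit_interval -` A \<inter> space (restrict_space lebesgue {0..1})
      \<in> sets (restrict_space lebesgue {0..1})"
    by (auto simp: sets_restrict_space space_restrict_space)
qed simp

lemma uniform_Omega_G_Omega:
  assumes "h \<in> borel \<rightarrow>\<^sub>M borel"
  shows "uniform_Omega h \<in> G_Omega"
proof -
  have "prob_space (restrict_space lebesgue {0..1::real})"
    by (rule prob_spaceI) (simp add: space_restrict_space emeasure_restrict_space)
  then have "prob_space uniform_I"
    unfolding uniform_I_def by (rule prob_space.prob_space_distr[OF _ measurable_Abs_unit_interval])
  moreover have "h \<in> uniform_I \<rightarrow>\<^sub>M B_Omega"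
    using measurable_universal1[OF assms] by (simp add: uniform_I_def measurable_universal_iff)
  ultimately show ?thesis
    by (auto simp: uniform_Omega_def space_prob_algebra intro!: prob_space.prob_space_distr)
qed

text \<open>Provides the uniform variable for \<open>randomization\<close>. A Borel \<open>u\<close>
  recovering the parameter from \<open>h\<close> is enough, which covers both a Borel isomorphism
  and the constant-sequence embedding of \<open>adm_R_le_S\<close>.\<close>

lemma emeasure_uniform_Omega:
  assumes h: "h \<in> borel \<rightarrow>\<^sub>M borel" and u: "u \<in> borel \<rightarrow>\<^sub>M borel"
    and uh: "\<And>x. u (h x) = Rep_unit_interval x" and B: "B \<in> sets borel"
  shows "emeasure (uniform_Omega h) (u -` B) = emeasure lborel (B \<inter> {0..1})"
proof -
  have uB: "u -` B \<in> sets B_Omega"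
    using measurable_sets[OF u B] sets_universal_superset[of borel] by auto
  have hU: "h \<in> uniform_I \<rightarrow>\<^sub>M B_Omega"
    using measurable_universal1[OF h] by (simp add: uniform_I_def measurable_universal_iff)
  have RB: "Rep_unit_interval -` B \<in> sets (universal borel)"
    using measurable_sets[OF measurable_Rep_unit_interval B] sets_universal_superset[of borel] by auto
  have "emeasure (uniform_Omega h) (u -` B) = emeasure uniform_I (Rep_unit_interval -` B)"
    unfolding uniform_Omega_def
    by (subst emeasure_distr[OF hU uB]) (simp add: uniform_I_def vimage_def uh)
  also have "\<dots> = emeasure (restrict_space lebesgue {0..1}) (Abs_unit_interval -` Rep_unit_interval -` B \<inter> {0..1})"
    unfolding uniform_I_def
    by (subst emeasure_distr[OF measurable_Abs_unit_interval RB]) (simp add: space_restrict_space)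
  also have "Abs_unit_interval -` Rep_unit_interval -` B \<inter> {0..1} = B \<inter> {0..1}"
    by (auto simp: Abs_unit_interval_inverse)
  also have "emeasure (restrict_space lebesgue {0..1}) (B \<inter> {0..1}) = emeasure lborel (B \<inter> {0..1})"
    using B by (subst emeasure_restrict_space) auto
  finally show ?thesis .
qed

section \<open>Spaces of push-forward measures\<close>

lemma adm_K_le_R:
  assumes X: "quasi_universal X"
  shows "adm (K_space X) \<subseteq> adm (R_space X)"
proof
  fix \<alpha> assume "\<alpha> \<in> adm (K_space X)"
  then obtain Z \<kappa> where Z: "Z \<in> adm (rv_qspace X)" and \<kappa>: "\<kappa> \<in> adm Q_Omega"
    and \<alpha>: "\<alpha> = (\<lambda>\<omega>. push X (Z \<omega>) (\<kappa> \<omega>))"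
    by (auto simp: K_space_def)
  \<comment> \<open>One fixed variable reads both arguments of \<open>Z\<close> from a coded pair;
    \<open>\<kappa>'\<close> below supplies the code of \<open>\<omega>\<close> and a sample from
    \<open>\<kappa> \<omega>\<close>.\<close>
  define Y where "Y t = Z (evens t) (odds t)" for t
  have Y: "Y \<in> adm X"
    using Z measurable_evens measurable_odds unfolding Y_def adm_rv_iff[OF X]
    by (blast intro: adm_OmegaI)
  define \<kappa>' where "\<kappa>' \<omega> = distr (\<kappa> \<omega>) B_Omega (interleave \<omega>)" for \<omega>
  have il: "interleave \<omega> \<in> adm Omega" for \<omega>
    by (intro adm_OmegaI measurable_interleave) auto
  have \<kappa>G: "\<kappa> \<omega> \<in> G_Omega" for \<omega>
    using \<kappa> by (auto simp: Q_Omega_def Q_points_eq_G_Omega)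
  have sets\<kappa>: "sets (\<kappa> \<omega>) = sets B_Omega" "space (\<kappa> \<omega>) = UNIV" for \<omega>
    using \<kappa>G[of \<omega>] by (auto simp: space_prob_algebra dest: sets_eq_imp_space_eq)
  have "\<kappa>' \<in> adm Q_Omega"
    unfolding Q_Omega_def qspace.sel
  proof (intro CollectI conjI ballI)
    show "range \<kappa>' \<subseteq> Q_points"
      using distr_G_Omega[OF \<kappa>G il] by (auto simp: Q_points_eq_G_Omega \<kappa>'_def)
    fix \<Phi> D assume \<Phi>: "\<Phi> \<in> adm Omega" and D: "D \<in> B_Omega2"
    \<comment> \<open>Absorbing the coding into the test set reduces the condition on
      \<open>\<kappa>'\<close> for \<open>D\<close> to that on \<open>\<kappa>\<close> for
      \<open>?D\<close>, with the same \<open>\<Phi>\<close>.\<close>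
    let ?D = "{(\<omega>, \<omega>'). (\<omega>, interleave (\<Phi> \<omega>) \<omega>') \<in> D}"
    have "?D \<in> B_Omega2"
      unfolding mem_B_Omega2_iff
    proof (intro ballI)
      fix U V assume U: "U \<in> adm Omega" and V: "V \<in> adm Omega"
      have "(\<lambda>\<omega>. interleave (\<Phi> (U \<omega>)) (V \<omega>)) \<in> adm Omega"
        using adm_comp[OF quasi_universal_Omega \<Phi> U] V by (simp add: adm_Omega_iff measurable_interleave)
      then show "{\<omega>. (U \<omega>, V \<omega>) \<in> ?D} \<in> sets B_Omega"
        using D U unfolding mem_B_Omega2_iff by simp
    qed
    then have "(\<lambda>\<omega>. emeasure (\<kappa> (\<Phi> \<omega>)) (Pair \<omega> -` ?D)) \<in> borel_measurable B_Omega"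
      using \<kappa> \<Phi> unfolding Q_Omega_def qspace.sel by blast
    moreover have "emeasure (\<kappa>' (\<Phi> \<omega>)) (Pair \<omega> -` D) = emeasure (\<kappa> (\<Phi> \<omega>)) (Pair \<omega> -` ?D)" for \<omega>
    proof -
      have "interleave (\<Phi> \<omega>) \<in> \<kappa> (\<Phi> \<omega>) \<rightarrow>\<^sub>M B_Omega"
        using il by (simp add: adm_Omega measurable_cong_sets[OF sets\<kappa>(1) refl])
      then show ?thesis
        using B_Omega2_section[OF D] by (simp add: \<kappa>'_def emeasure_distr sets\<kappa> vimage_def)
    qed
    ultimately show "(\<lambda>\<omega>. emeasure (\<kappa>' (\<Phi> \<omega>)) (Pair \<omega> -` D)) \<in> borel_measurable B_Omega"
      by simp
  qed
  moreover have "\<alpha> \<omega> = push X Y (\<kappa>' \<omega>)" for \<omega>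
    unfolding \<alpha> \<kappa>'_def by (subst push_distr[OF X Y il sets\<kappa>(1)]) (simp add: Y_def)
  ultimately show "\<alpha> \<in> adm (R_space X)"
    using Y unfolding R_space_def by auto
qed

lemma adm_R_uniform:
  assumes "h \<in> borel \<rightarrow>\<^sub>M borel" "u \<in> borel \<rightarrow>\<^sub>M borel" "\<And>x. u (h x) = Rep_unit_interval x"
    and "\<alpha> \<in> adm (R_space X)"
  obtains Y \<phi> where "Y \<in> adm X" "\<phi> \<in> adm (rv_qspace Omega)"
    "\<alpha> = (\<lambda>\<omega>. push X Y (distr (uniform_Omega h) B_Omega (\<phi> \<omega>)))"
proof -
  obtain Y \<kappa> where Y: "Y \<in> adm X" and \<kappa>: "\<kappa> \<in> adm Q_Omega" and \<alpha>: "\<alpha> = (\<lambda>\<omega>. push X Y (\<kappa> \<omega>))"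
    using assms(4) by (auto simp: R_space_def)
  obtain \<phi> where "\<phi> \<in> adm (rv_qspace Omega)" "\<And>\<omega>. \<kappa> \<omega> = distr (uniform_Omega h) B_Omega (\<phi> \<omega>)"
    using randomization[OF \<kappa> uniform_Omega_G_Omega[OF assms(1)] assms(2)
        emeasure_uniform_Omega[OF assms(1,2,3)]] by blast
  then show thesis
    using Y \<alpha> by (intro that) auto
qed

lemma adm_S_le_P:
  assumes X: "quasi_universal X"
  shows "adm (S_space X) \<subseteq> adm (P_space X)"
proof
  fix \<alpha> assume "\<alpha> \<in> adm (S_space X)"
  then obtain Y \<phi> P where *: "Y \<in> adm X" "\<phi> \<in> adm (rv_qspace Omega)" "P \<in> G_Omega"
    and \<alpha>: "\<alpha> = (\<lambda>\<omega>. push X Y (distr P B_Omega (\<phi> \<omega>)))"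
    by (auto simp: S_space_def)
  have "\<alpha> = (\<lambda>\<omega>. push X (\<lambda>\<omega>'. Y (\<phi> \<omega> \<omega>')) P)"
    unfolding \<alpha> using *
    by (intro ext push_distr[OF X]) (auto simp: space_prob_algebra adm_rv_apply)
  then show "\<alpha> \<in> adm (P_space X)"
    using adm_rv_comp[OF X *(1,2)] *(3) by (auto simp: P_space_def)
qed

text \<open>A fixed \<open>P\<close> is a constant kernel; its admissibility is the Fubini
  argument.\<close>

lemma adm_P_le_K: "adm (P_space X) \<subseteq> adm (K_space X)"
  using const_adm_Q_Omega by (fastforce simp: P_space_def K_space_def)

lemma adm_R_le_S: "adm (R_space X) \<subseteq> adm (S_space X)"
proof
  fix \<alpha> assume \<alpha>: "\<alpha> \<in> adm (R_space X)"
  \<comment> \<open>No Borel isomorphism is given here. The embedding by constant sequences,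
    inverted by coordinate 0, gives a measure carrying a uniform variable.\<close>
  have h: "(\<lambda>t _. t :: unit_interval) \<in> borel \<rightarrow>\<^sub>M (borel :: omega measure)"
    by (intro measurable_coordinatewise_then_product) auto
  have u: "(\<lambda>\<omega>::omega. Rep_unit_interval (\<omega> 0)) \<in> borel \<rightarrow>\<^sub>M borel"
    by (rule measurable_compose[OF measurable_product_coordinates measurable_Rep_unit_interval])
  obtain Y \<phi> where "Y \<in> adm X" "\<phi> \<in> adm (rv_qspace Omega)"
    "\<alpha> = (\<lambda>\<omega>. push X Y (distr (uniform_Omega (\<lambda>t _. t)) B_Omega (\<phi> \<omega>)))"
    using adm_R_uniform[OF h u refl \<alpha>] by blast
  then show "\<alpha> \<in> adm (S_space X)"
    using uniform_Omega_G_Omega[OF h] by (auto simp: S_space_def)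
qed

text \<open>The points agree by \<open>Q_points_eq_G_Omega\<close>; the admissible variables agree
  by the cycle of inclusions K, R, S, P, K.\<close>

lemma push_spaces_eq:
  assumes "quasi_universal X"
  shows "S_space X = P_space X" "P_space X = R_space X" "R_space X = K_space X"
proof -
  have "points (S_space X) = points (P_space X)" "points (P_space X) = points (R_space X)"
    "points (R_space X) = points (K_space X)"
    by (auto simp: S_space_def P_space_def R_space_def K_space_def Q_Omega_def Q_points_eq_G_Omega)
  moreover have "adm (S_space X) = adm (P_space X)" "adm (P_space X) = adm (R_space X)"
    "adm (R_space X) = adm (K_space X)"
    using adm_K_le_R[OF assms] adm_S_le_P[OF assms] adm_P_le_K[of X] adm_R_le_S[of X] by auto
  ultimately show "S_space X = P_space X" "P_space X = R_space X" "R_space X = K_space X"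
    by (auto intro: qspace.expand)
qed

lemma quasi_universal_P_space:
  assumes X: "quasi_universal X"
  shows "quasi_universal (P_space X)"
  unfolding quasi_universal_def
proof (intro conjI ballI)
  fix \<alpha> assume "\<alpha> \<in> adm (P_space X)"
  then obtain Z P where Z: "Z \<in> adm (rv_qspace X)" "P \<in> G_Omega" "\<alpha> = (\<lambda>\<omega>. push X (Z \<omega>) P)"
    by (auto simp: P_space_def)
  then show "range \<alpha> \<subseteq> points (P_space X)"
    using adm_rv_apply[OF Z(1)] by (auto simp: P_space_def)
  fix \<Phi> assume "\<Phi> \<in> adm Omega"
  then have "(\<lambda>\<omega>. Z (\<Phi> \<omega>)) \<in> adm (rv_qspace X)"
    by (rule adm_comp[OF quasi_universal_rv[OF X] Z(1)])
  then show "\<alpha> \<circ> \<Phi> \<in> adm (P_space X)"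
    using Z by (auto simp: P_space_def o_def)
next
  fix m assume "m \<in> points (P_space X)"
  then show "(\<lambda>_. m) \<in> adm (P_space X)"
    using adm_rv_const[OF X] by (fastforce simp: P_space_def)
qed

theorem theoremF29:
  fixes X :: "'a qspace"
  assumes "quasi_universal X"
  shows "S_space X = P_space X \<and> P_space X = R_space X \<and> R_space X = K_space X \<and>
    (\<forall>h \<nu>. borel_isomorphism h \<and> \<nu> = uniform_Omega h \<longrightarrow>
       points (P_space X) = {push X Y \<nu> | Y. Y \<in> adm X} \<and>
       adm (P_space X) =
         {\<lambda>\<omega>. push X Y (distr \<nu> B_Omega (\<phi> \<omega>)) | Y \<phi>. Y \<in> adm X \<and> \<phi> \<in> adm (rv_qspace Omega)} \<and>
       quasi_quotient_map (rv_qspace X) (P_space X) (\<lambda>Y. push X Y \<nu>))"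
proof (intro conjI allI impI push_spaces_eq assms)
  fix h \<nu> assume h\<nu>: "borel_isomorphism h \<and> \<nu> = uniform_Omega h"
  \<comment> \<open>The uniform variable is now the inverse isomorphism, read as a real
    number.\<close>
  then have h: "h \<in> borel \<rightarrow>\<^sub>M borel" and u: "(\<lambda>\<omega>. Rep_unit_interval (inv h \<omega>)) \<in> borel \<rightarrow>\<^sub>M borel"
    and uh: "\<And>x. Rep_unit_interval (inv h (h x)) = Rep_unit_interval x"
    by (auto simp: borel_isomorphism_def bij_is_inj intro: measurable_compose[OF _ measurable_Rep_unit_interval])
  have \<nu>: "\<nu> \<in> G_Omega" "sets \<nu> = sets B_Omega"
    using uniform_Omega_G_Omega[OF h] h\<nu> by (auto simp: space_prob_algebra)
  show adm_eq: "adm (P_space X) =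
      {\<lambda>\<omega>. push X Y (distr \<nu> B_Omega (\<phi> \<omega>)) | Y \<phi>. Y \<in> adm X \<and> \<phi> \<in> adm (rv_qspace Omega)}"
    (is "_ = ?R")
  proof
    show "adm (P_space X) \<subseteq> ?R"
    proof
      fix \<alpha> assume "\<alpha> \<in> adm (P_space X)"
      then have "\<alpha> \<in> adm (R_space X)" by (simp add: push_spaces_eq[OF assms])
      from adm_R_uniform[OF h u uh this] show "\<alpha> \<in> ?R"
        using h\<nu> by blast
    qed
    show "?R \<subseteq> adm (P_space X)"
      using \<nu>(1) unfolding push_spaces_eq(1)[OF assms, symmetric] by (auto simp: S_space_def)
  qed
  have adm_rv: "adm (P_space X) = (\<lambda>Z. (\<lambda>Y. push X Y \<nu>) \<circ> Z) ` adm (rv_qspace X)" (is "_ = ?L")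
  proof
    show "adm (P_space X) \<subseteq> ?L"
    proof
      fix \<alpha> assume "\<alpha> \<in> adm (P_space X)"
      then obtain Y \<phi> where Y: "Y \<in> adm X" and \<phi>: "\<phi> \<in> adm (rv_qspace Omega)"
        and \<alpha>: "\<alpha> = (\<lambda>\<omega>. push X Y (distr \<nu> B_Omega (\<phi> \<omega>)))"
        unfolding adm_eq by auto
      have "\<alpha> = (\<lambda>Y. push X Y \<nu>) \<circ> (\<lambda>\<omega> \<omega>'. Y (\<phi> \<omega> \<omega>'))"
        using push_distr[OF assms Y adm_rv_apply[OF \<phi>] \<nu>(2)] by (auto simp: \<alpha>)
      then show "\<alpha> \<in> ?L"
        using adm_rv_comp[OF assms Y \<phi>] by blast
    qed
    show "?L \<subseteq> adm (P_space X)"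
      using \<nu>(1) by (auto simp: P_space_def o_def)
  qed
  show points_eq: "points (P_space X) = {push X Y \<nu> | Y. Y \<in> adm X}" (is "_ = ?S")
  proof
    show "points (P_space X) \<subseteq> ?S"
    proof
      fix m assume "m \<in> points (P_space X)"
      \<comment> \<open>Points are read off from constant random variables: the constant
        \<open>m\<close> lifts to some \<open>Z\<close>, and every value of \<open>Z\<close>
        represents \<open>m\<close>, in particular the one at \<open>undefined\<close>.\<close>
      then have "(\<lambda>_. m) \<in> adm (P_space X)"
        by (intro adm_const quasi_universal_P_space assms)
      then obtain Z where "Z \<in> adm (rv_qspace X)" "(\<lambda>_. m) = (\<lambda>Y. push X Y \<nu>) \<circ> Z"
        unfolding adm_rv by auto
      then show "m \<in> ?S"
        using adm_rv_apply[of Z X undefined] by (auto simp: fun_eq_iff)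
    qed
    show "?S \<subseteq> points (P_space X)"
      using \<nu>(1) by (auto simp: P_space_def)
  qed
  have "points (rv_qspace X) = adm X" by (simp add: rv_qspace_def)
  then show "quasi_quotient_map (rv_qspace X) (P_space X) (\<lambda>Y. push X Y \<nu>)"
    unfolding quasi_quotient_map_def quasi_measurable_def
    using quasi_universal_rv[OF assms] quasi_universal_P_space[OF assms] points_eq adm_rv by auto
qed

end
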